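(* Let $n,k\ge1$ and $t\ge1$ be integers and let $\mathcal{A}\subset 2^{[n]}$ be a family all of whose members have at most $k$ elements. Let $\mathcal{F}\subset\mathcal{A}$ be $t$-intersecting. Let $q,\tau\ge1$ and suppose $\mathcal{A}$ is $(r_0,q)$-spread for some $r_0$ with $r_0\ge 2\tau q$ and $r_0>2^{12}\tau\log_2(2k)$. Then there exist a $t$-intersecting family $\mathcal{S}$ of sets of size at most $q$ and a family $\mathcal{F}'\subset\mathcal{F}$ such that: (i) every set in $\mathcal{F}\setminus\mathcal{F}'$ contains at least one set of $\mathcal{S}$; (ii) for every $B\in\mathcal{S}$ there is a family $\mathcal{F}_B\subset\mathcal{F}$ such that $\mathcal{F}_B(B)$ is $(\mathcal{A}(B),\tau)$-homogeneous; (iii) $|\mathcal{F}'|\le\tau^{-q-1}|\mathcal{A}|$.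
   Context: A family is $t$-intersecting if any two of its members (not necessarily distinct) share at least $t$ elements. For a family $\mathcal{G}$ and a set $S$, $\mathcal{G}(S)=\{A\setminus S: A\in\mathcal{G},\ S\subset A\}$. A family $\mathcal{G}$ is $r$-spread if $|\mathcal{G}(X)|\le r^{-|X|}|\mathcal{G}|$ for every set $X$. A family $\mathcal{A}\subset2^{[n]}$ is $(r,q)$-spread if $\mathcal{A}(S)$ is $r$-spread for every $S\subset[n]$ with $|S|\le q$. For families $\mathcal{G}\subset\mathcal{B}$ and $\tau>1$, $\mathcal{G}$ is $(\mathcal{B},\tau)$-homogeneous if for every set $S$, $\frac{|\mathcal{G}(S)|}{|\mathcal{G}|}\le\tau^{|S|}\frac{|\mathcal{B}(S)|}{|\mathcal{B}|}$. *)

theory Defs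
  imports Complex_Main
begin

definition t_intersecting :: "nat \<Rightarrow> 'a set set \<Rightarrow> bool" where
  "t_intersecting t \<F> \<longleftrightarrow> (\<forall>A\<in>\<F>. \<forall>B\<in>\<F>. t \<le> card (A \<inter> B))"

definition link :: "'a set set \<Rightarrow> 'a set \<Rightarrow> 'a set set" where
  "link \<G> S = {A - S | A. A \<in> \<G> \<and> S \<subseteq> A}"

definition spread :: "real \<Rightarrow> 'a set set \<Rightarrow> bool" where
  "spread r \<G> \<longleftrightarrow>
    (\<forall>X. real (card (link \<G> X)) \<le> r powi (- int (card X)) * real (card \<G>))"

definition rq_spread :: "nat \<Rightarrow> real \<Rightarrow> nat \<Rightarrow> nat set set \<Rightarrow> bool" where
  "rq_spread n r q \<A> \<longleftrightarrow>
    \<A> \<subseteq> Pow {1..n} \<and> (\<forall>S. S \<subseteq> {1..n} \<and> card S \<le> q \<longrightarrow> spread r (link \<A> S))"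

text \<open>
  Nonemptiness of \<open>\<G>\<close>, implicit in the division by \<open>|\<G>|\<close>, is required explicitly: since
  \<open>x / 0 = 0\<close> in HOL, the empty family would otherwise be homogeneous with respect to
  every \<open>\<B>\<close>.
\<close>

definition homogeneous :: "'a set set \<Rightarrow> real \<Rightarrow> 'a set set \<Rightarrow> bool" where
  "homogeneous \<B> \<tau> \<G> \<longleftrightarrow>
    \<G> \<subseteq> \<B> \<and> \<G> \<noteq> {} \<and>
    (\<forall>S. real (card (link \<G> S)) / real (card \<G>)
          \<le> \<tau> ^ card S * (real (card (link \<B> S)) / real (card \<B>)))"

end

theory Submission
  imports Defs
begin

text \<open>
  Peel off \<open>\<F>\<close> greedily: a set \<open>S\<close> that is inclusion-maximal with
  \<open>|\<F>(S)| / |\<F>| \<ge> \<tau>^|S| |\<A>(S)| / |\<A>|\<close> has a homogeneous link \<open>\<F>(S)\<close>. If \<open>|S| > q\<close>, what is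
  left of \<open>\<F>\<close> is small and becomes \<open>\<F>'\<close>; otherwise record \<open>S\<close>, delete its supersets and repeat.

  For recorded \<open>S\<close>, \<open>S'\<close>, spreadness of \<open>\<A>(S)\<close> and homogeneity make \<open>\<F>(S)\<close> spread, and at least
  half of its members avoid \<open>S'\<close>. A uniformly random set contains a member of such a family with
  probability above \<open>1/2\<close>, so a random set and its complement yield disjoint members for \<open>S\<close> and
  \<open>S'\<close>. Adding back \<open>S\<close> and \<open>S'\<close> gives two members of \<open>\<F>\<close> meeting exactly in \<open>S \<inter> S'\<close>.

  The probability bound is the minimal fragment argument of Park and Pham: the random set is a union of
  about \<open>log\<^sub>2 k\<close> sparse independent sets \<open>W\<close>, and after exposing each of them almost every member of
  the family has a fragment \<open>B - W\<close> (\<open>B\<close> in the family) of less than half the previous size bound.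
\<close>

section \<open>Biased random subsets\<close>

text \<open>The parameter \<open>s\<close> is the probability that a point is left out: for
  independent unions the omission probabilities simply multiply.\<close>

definition subset_weight :: "real \<Rightarrow> 'a set \<Rightarrow> 'a set \<Rightarrow> real" where
  "subset_weight s V W = (1 - s) ^ card W * s ^ card (V - W)"

lemma subset_weight_nonneg: "0 \<le> s \<Longrightarrow> s \<le> 1 \<Longrightarrow> 0 \<le> subset_weight s V W"
  by (simp add: subset_weight_def)

lemma sum_Pow_insert:
  fixes h :: "'a set \<Rightarrow> 'b::comm_monoid_add"
  assumes "finite V" "x \<notin> V"
  shows "(\<Sum>W\<in>Pow (insert x V). h W) = (\<Sum>W\<in>Pow V. h W + h (insert x W))"
proof -
  have inj: "inj_on (insert x) (Pow V)"
    using assms by (auto simp: inj_on_def)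
  have "(\<Sum>W\<in>Pow (insert x V). h W) = sum h (Pow V) + sum h (insert x ` Pow V)"
    unfolding Pow_insert using assms by (intro sum.union_disjoint) auto
  also have "sum h (insert x ` Pow V) = (\<Sum>W\<in>Pow V. h (insert x W))"
    using inj by (simp add: sum.reindex)
  finally show ?thesis by (simp add: sum.distrib)
qed

lemma subset_weight_insert:
  assumes "finite V" "x \<notin> V" "W \<subseteq> V"
  shows "subset_weight s (insert x V) W = s * subset_weight s V W"
    and "subset_weight s (insert x V) (insert x W) = (1 - s) * subset_weight s V W"
proof -
  have fin: "finite W" "finite (V - W)" and x: "x \<notin> W"
    using assms finite_subset by auto
  have "insert x V - W = insert x (V - W)" "insert x V - insert x W = V - W"
    using assms by auto
  then show "subset_weight s (insert x V) W = s * subset_weight s V W"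
    "subset_weight s (insert x V) (insert x W) = (1 - s) * subset_weight s V W"
    using assms fin x by (simp_all add: subset_weight_def)
qed

lemma sum_subset_weight:
  assumes "finite V"
  shows "(\<Sum>W\<in>Pow V. subset_weight s V W) = 1"
  using assms
proof (induction V)
  case empty
  then show ?case by (simp add: subset_weight_def)
next
  case (insert x V)
  have "(\<Sum>W\<in>Pow (insert x V). subset_weight s (insert x V) W) = (\<Sum>W\<in>Pow V. subset_weight s V W)"
    unfolding sum_Pow_insert[OF insert.hyps]
    by (intro sum.cong refl)
      (use insert.hyps in \<open>auto simp: subset_weight_insert algebra_simps\<close>)
  then show ?case using insert.IH by simp
qed

text \<open>A point is missing from \<open>W \<union> W'\<close> exactly when both independent sets
  miss it, which has probability \<open>s * s'\<close>. The test function \<open>g\<close> is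
  arbitrary so that the induction can absorb the new point into it.\<close>

lemma subset_weight_convolution:
  assumes "finite V"
  shows "(\<Sum>W\<in>Pow V. \<Sum>W'\<in>Pow V. subset_weight s V W * subset_weight s' V W' * g (W \<union> W'))
    = (\<Sum>W\<in>Pow V. subset_weight (s * s') V W * g W)"
  using assms
proof (induction V arbitrary: g)
  case empty
  then show ?case by (simp add: subset_weight_def)
next
  case (insert x V)
  \<comment> \<open>This averages \<open>g\<close> over the fate of \<open>x\<close> in the
    union.\<close>
  let ?g = "\<lambda>U. s * s' * g U + (1 - s * s') * g (insert x U)"
  have "(\<Sum>W\<in>Pow (insert x V). \<Sum>W'\<in>Pow (insert x V).
        subset_weight s (insert x V) W * subset_weight s' (insert x V) W' * g (W \<union> W'))
    = (\<Sum>W\<in>Pow V. \<Sum>W'\<in>Pow V. subset_weight s V W * subset_weight s' V W' * ?g (W \<union> W'))"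
    unfolding sum_Pow_insert[OF insert.hyps] sum.distrib[symmetric]
    by (intro sum.cong refl)
      (use insert.hyps in \<open>auto simp: subset_weight_insert algebra_simps\<close>)
  also have "\<dots> = (\<Sum>W\<in>Pow V. subset_weight (s * s') V W * ?g W)"
    by (rule insert.IH)
  also have "\<dots> = (\<Sum>W\<in>Pow (insert x V). subset_weight (s * s') (insert x V) W * g W)"
    unfolding sum_Pow_insert[OF insert.hyps]
    by (intro sum.cong refl)
      (use insert.hyps in \<open>auto simp: subset_weight_insert algebra_simps\<close>)
  finally show ?case .
qed

text \<open>Each point of \<open>T\<close> moved into the set replaces a factor \<open>s\<close> by
  \<open>1 - s\<close>. This is the price of encoding \<open>W\<close> by
  \<open>W \<union> T\<close> in the fragment count.\<close>

lemma subset_weight_Un: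
  assumes "finite V" "W \<subseteq> V" "T \<subseteq> V" "T \<inter> W = {}" "s < 1"
  shows "subset_weight s V W = subset_weight s V (W \<union> T) * (s / (1 - s)) ^ card T"
proof -
  have fin: "finite W" "finite T"
    using assms finite_subset by blast+
  have "card (V - W) = card ((V - (W \<union> T)) \<union> T)"
    using assms by (intro arg_cong[where f = card]) auto
  also have "\<dots> = card (V - (W \<union> T)) + card T"
    using assms fin by (intro card_Un_disjoint) auto
  finally have c: "card (V - W) = card (V - (W \<union> T)) + card T" .
  have "card (W \<union> T) = card W + card T"
    using assms fin by (intro card_Un_disjoint) auto
  then show ?thesis
    using assms(5) by (simp add: subset_weight_def c power_add power_divide)
qed

section \<open>Minimal fragments\<close>

text \<open>Choose \<open>T\<close> inclusion-minimal among the fragments \<open>f i' - W\<close>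
  inside \<open>f i\<close>. A member inside \<open>W \<union> T\<close> leaves a fragment inside
  \<open>T\<close>, which minimality forces to be \<open>T\<close> itself.\<close>

lemma minimal_fragment_exists:
  assumes "finite I" "i \<in> I"
  shows "\<exists>T. (\<exists>i'\<in>I. T = f i' - W) \<and> T \<subseteq> f i \<and> (\<forall>i'\<in>I. f i' \<subseteq> W \<union> T \<longrightarrow> T \<subseteq> f i')"
proof -
  define C where "C = {T \<in> (\<lambda>i'. f i' - W) ` I. T \<subseteq> f i}"
  have "finite C" "C \<noteq> {}"
    using assms by (auto simp: C_def)
  from finite_has_minimal[OF this]
  obtain T where T: "T \<in> C" and min: "\<And>T'. T' \<in> C \<Longrightarrow> T' \<subseteq> T \<Longrightarrow> T = T'"
    by blast
  have "T \<subseteq> f i'" if "i' \<in> I" "f i' \<subseteq> W \<union> T" for i'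
  proof -
    have "f i' - W \<in> C" "f i' - W \<subseteq> T"
      using that T by (auto simp: C_def)
    from min[OF this] show ?thesis by blast
  qed
  then show ?thesis using T by (auto simp: C_def)
qed

text \<open>
  A pair \<open>(W, i)\<close> is recovered from \<open>(W \<union> T, T, i)\<close>, where \<open>T\<close> is the fragment of \<open>i\<close>. By minimality
  \<open>T\<close> lies in every member of the family inside \<open>W \<union> T\<close>, which leaves at most \<open>2^b\<close> choices for \<open>T\<close>.
\<close>

lemma sum_large_fragments_le:
  fixes f :: "'i \<Rightarrow> 'a set" and T :: "'a set \<Rightarrow> 'i \<Rightarrow> 'a set" and s R N :: real
  assumes fin: "finite V" "finite I"
    and fV: "\<And>i. i \<in> I \<Longrightarrow> f i \<subseteq> V"
    and fb: "\<And>i. i \<in> I \<Longrightarrow> card (f i) \<le> b"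
    and s: "0 < s" "s < 1" and R: "0 < R" and sR: "64 * s \<le> R * (1 - s)"
    and spr: "\<And>X. X \<subseteq> V \<Longrightarrow> real (card {i\<in>I. X \<subseteq> f i}) * R ^ card X \<le> N"
    and Tf: "\<And>W i. i \<in> I \<Longrightarrow> \<exists>i'\<in>I. T W i = f i' - W"
    and Tsub: "\<And>W i. i \<in> I \<Longrightarrow> T W i \<subseteq> f i"
    and Tmin: "\<And>W i i'. i \<in> I \<Longrightarrow> i' \<in> I \<Longrightarrow> f i' \<subseteq> W \<union> T W i \<Longrightarrow> T W i \<subseteq> f i'"
  shows "(\<Sum>W\<in>Pow V. subset_weight s V W * real (card {i\<in>I. d \<le> card (T W i)}))
    \<le> N * (2 ^ b * (1 / 64) ^ d)"
proof -
  define c where "c = s / (1 - s)"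
  have c: "0 < c" "c / R \<le> 1 / 64"
    using s R sR by (auto simp: c_def field_simps)
  have N: "0 \<le> N"
    using spr[of "{}"] by simp
  \<comment> \<open>\<open>B Z\<close> is a member inside \<open>Z\<close> chosen from
    \<open>Z\<close> alone, so a decoder that sees only \<open>Z = W \<union> T\<close> can look for
    \<open>T\<close> among its subsets. The default \<open>{}\<close> still satisfies the size
    bound.\<close>
  define B where "B Z = (if \<exists>i\<in>I. f i \<subseteq> Z then f (SOME i. i \<in> I \<and> f i \<subseteq> Z) else {})" for Z
  have B: "\<exists>i\<in>I. f i \<subseteq> Z \<and> B Z = f i" if "\<exists>i\<in>I. f i \<subseteq> Z" for Z
  proof -
    have "(SOME i. i \<in> I \<and> f i \<subseteq> Z) \<in> I \<and> f (SOME i. i \<in> I \<and> f i \<subseteq> Z) \<subseteq> Z"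
      by (rule someI_ex) (use that in blast)
    then show ?thesis
      using that unfolding B_def by auto
  qed
  have BV: "B Z \<subseteq> V" "card (B Z) \<le> b" for Z
  proof -
    have "B Z \<subseteq> V \<and> card (B Z) \<le> b"
    proof (cases "\<exists>i\<in>I. f i \<subseteq> Z")
      case True
      from B[OF this] obtain i where "i \<in> I" "B Z = f i" by blast
      then show ?thesis using fV fb by simp
    next
      case False
      then have "B Z = {}" unfolding B_def by (rule if_not_P)
      then show ?thesis by simp
    qed
    then show "B Z \<subseteq> V" "card (B Z) \<le> b" by auto
  qed
  have finB: "finite (B Z)" for Z
    using BV fin finite_subset by blast
  define P where "P = (SIGMA W:Pow V. {i\<in>I. d \<le> card (T W i)})"
  define Q where "Q = (SIGMA Z:Pow V. SIGMA T:{T\<in>Pow (B Z). d \<le> card T}. {i\<in>I. T \<subseteq> f i})"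
  define h where "h = (\<lambda>(W, i). (W \<union> T W i, T W i, i))"
  define w where "w = (\<lambda>(Z, T :: 'a set, i :: 'i). subset_weight s V Z * c ^ card T)"
  have finPQ: "finite P" "finite Q"
    unfolding P_def Q_def using fin finB by (auto intro!: finite_SigmaI)
  have disj: "T W i \<inter> W = {}" if "i \<in> I" for W i
    using Tf[OF that, of W] by auto
  \<comment> \<open>Since \<open>T W i\<close> is disjoint from \<open>W\<close>, the code returns
    \<open>W\<close> as the difference of its first two components.\<close>
  have inj: "inj_on h P"
  proof (rule inj_onI)
    fix p p' assume "p \<in> P" "p' \<in> P" "h p = h p'"
    moreover obtain W i W' i' where "p = (W, i)" "p' = (W', i')"
      by (cases p, cases p')
    ultimately show "p = p'"
      using disj[of i W] disj[of i' W'] by (auto simp: h_def P_def)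
  qed
  have hPQ: "h ` P \<subseteq> Q"
  proof -
    have "h (W, i) \<in> Q" if W: "W \<subseteq> V" and i: "i \<in> I" "d \<le> card (T W i)" for W i
    proof -
      obtain i' where i': "i' \<in> I" "T W i = f i' - W"
        using Tf[OF i(1)] by blast
      have "f i' \<subseteq> W \<union> T W i"
        unfolding i'(2) by blast
      with i'(1) have "\<exists>i'\<in>I. f i' \<subseteq> W \<union> T W i"
        by (rule bexI[rotated])
      from B[OF this] obtain i'' where "i'' \<in> I" "f i'' \<subseteq> W \<union> T W i" "B (W \<union> T W i) = f i''"
        by blast
      with Tmin[OF i(1), of i'' W] have "T W i \<subseteq> B (W \<union> T W i)"
        by simp
      then show ?thesis
        using W i Tsub[OF i(1), of W] fV[OF i(1)] by (auto simp: Q_def h_def)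
    qed
    then show ?thesis by (auto simp: P_def)
  qed
  have w_nonneg: "0 \<le> w z" for z
    using s c by (cases z) (auto simp: w_def intro!: mult_nonneg_nonneg subset_weight_nonneg)
  have "(\<Sum>W\<in>Pow V. subset_weight s V W * real (card {i\<in>I. d \<le> card (T W i)}))
      = (\<Sum>W\<in>Pow V. \<Sum>i\<in>{i\<in>I. d \<le> card (T W i)}. subset_weight s V W)"
    by (simp add: mult.commute)
  also have "\<dots> = (\<Sum>(W, i)\<in>P. subset_weight s V W)"
    unfolding P_def using fin by (subst sum.Sigma) auto
  also have "\<dots> = (\<Sum>p\<in>P. w (h p))"
  proof (rule sum.cong[OF refl])
    fix p assume "p \<in> P"
    then obtain W i where p: "p = (W, i)" "W \<subseteq> V" "i \<in> I"
      by (auto simp: P_def)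
    have "subset_weight s V W = subset_weight s V (W \<union> T W i) * c ^ card (T W i)"
      unfolding c_def using p fin(1) Tsub fV disj s by (intro subset_weight_Un) blast+
    then show "(case p of (W, i) \<Rightarrow> subset_weight s V W) = w (h p)"
      by (simp add: p w_def h_def)
  qed
  also have "\<dots> = sum w (h ` P)"
    using inj by (simp add: sum.reindex)
  also have "\<dots> \<le> sum w Q"
    using finPQ hPQ w_nonneg by (intro sum_mono2) auto
  also have "\<dots> = (\<Sum>Z\<in>Pow V. \<Sum>T\<in>{T\<in>Pow (B Z). d \<le> card T}. \<Sum>i\<in>{i\<in>I. T \<subseteq> f i}.
      subset_weight s V Z * c ^ card T)"
    unfolding Q_def w_def using fin finB
    by (simp add: sum.Sigma[symmetric] finite_SigmaI del: sum_constant)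
  also have "\<dots> = (\<Sum>Z\<in>Pow V. subset_weight s V Z * (\<Sum>T\<in>{T\<in>Pow (B Z). d \<le> card T}.
      c ^ card T * real (card {i\<in>I. T \<subseteq> f i})))"
    by (simp add: sum_distrib_left mult_ac)
  also have "\<dots> \<le> (\<Sum>Z\<in>Pow V. subset_weight s V Z * (N * (2 ^ b * (1 / 64) ^ d)))"
  proof (intro sum_mono mult_left_mono)
    fix Z
    have "(\<Sum>T\<in>{T\<in>Pow (B Z). d \<le> card T}. c ^ card T * real (card {i\<in>I. T \<subseteq> f i}))
        \<le> (\<Sum>T\<in>{T\<in>Pow (B Z). d \<le> card T}. N * (1 / 64) ^ d)"
    proof (rule sum_mono)
      fix T assume T: "T \<in> {T\<in>Pow (B Z). d \<le> card T}"
      \<comment> \<open>Reweighting costs \<open>c\<close> per point of \<open>T\<close> and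
        spreadness gains \<open>R\<close> per point, so each \<open>T\<close> contributes at most
        \<open>N * (c / R) ^ card T\<close>.\<close>
      have "c ^ card T * real (card {i\<in>I. T \<subseteq> f i})
          = (c / R) ^ card T * (real (card {i\<in>I. T \<subseteq> f i}) * R ^ card T)"
        using R by (simp add: power_divide)
      also have "\<dots> \<le> (1 / 64) ^ d * N"
      proof (rule mult_mono)
        have "(c / R) ^ card T \<le> (1 / 64) ^ card T"
          using c R by (intro power_mono) auto
        also have "\<dots> \<le> (1 / 64) ^ d"
          using T by (intro power_decreasing) auto
        finally show "(c / R) ^ card T \<le> (1 / 64) ^ d" .
        show "real (card {i\<in>I. T \<subseteq> f i}) * R ^ card T \<le> N"
          using T BV by (intro spr) auto
      qed (use R in auto)
      finally show "c ^ card T * real (card {i\<in>I. T \<subseteq> f i}) \<le> N * (1 / 64) ^ d"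
        by (simp add: mult.commute)
    qed
    also have "\<dots> = real (card {T\<in>Pow (B Z). d \<le> card T}) * (N * (1 / 64) ^ d)"
      by simp
    also have "\<dots> \<le> 2 ^ b * (N * (1 / 64) ^ d)"
    proof (rule mult_right_mono)
      have "card {T\<in>Pow (B Z). d \<le> card T} \<le> card (Pow (B Z))"
        using finB by (intro card_mono) auto
      also have "\<dots> \<le> 2 ^ b"
        using BV finB by (simp add: card_Pow)
      finally show "real (card {T\<in>Pow (B Z). d \<le> card T}) \<le> 2 ^ b"
        by (metis of_nat_le_iff of_nat_numeral of_nat_power)
    qed (use N in auto)
    finally show "(\<Sum>T\<in>{T\<in>Pow (B Z). d \<le> card T}. c ^ card T * real (card {i\<in>I. T \<subseteq> f i}))
        \<le> N * (2 ^ b * (1 / 64) ^ d)"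
      by (simp add: mult_ac)
  qed (use s in \<open>auto intro: subset_weight_nonneg\<close>)
  also have "\<dots> = N * (2 ^ b * (1 / 64) ^ d)"
    using sum_subset_weight[OF fin(1), of s] by (simp add: sum_distrib_right[symmetric])
  finally show ?thesis .
qed

text \<open>
  The bound carries the deficit \<open>N - |I|\<close>, so that members with a large fragment can be dropped from
  \<open>I\<close> while the spreadness assumption stays relative to the original size \<open>N\<close>.
\<close>

lemma spread_miss_weight_le:
  fixes f :: "'i \<Rightarrow> 'a set" and s R N :: real
  assumes "finite V" "finite I"
    and "\<And>i. i \<in> I \<Longrightarrow> f i \<subseteq> V" "\<And>i. i \<in> I \<Longrightarrow> card (f i) < 2 ^ j"
    and "0 < s" "s < 1" "0 < R" "64 * s \<le> R * (1 - s)"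
    and "\<And>X. X \<subseteq> V \<Longrightarrow> real (card {i\<in>I. X \<subseteq> f i}) * R ^ card X \<le> N"
  shows "N * (\<Sum>W\<in>Pow V. subset_weight (s ^ j) V W * of_bool (\<forall>i\<in>I. \<not> f i \<subseteq> W))
    \<le> N - real (card I) + N * ((1 - (1 / 2) ^ j) / 2)"
  using assms(2-4,9)
proof (induction j arbitrary: I f)
  case 0
  \<comment> \<open>Size below \<open>2 ^ 0\<close> means empty, so a nonempty family is never
    missed. For empty \<open>I\<close> the deficit is all of \<open>N\<close> and covers the trivial
    bound.\<close>
  have fe: "f i = {}" if "i \<in> I" for i
    using 0(2,3)[OF that] assms(1) finite_subset by fastforce
  show ?case
  proof (cases "I = {}")
    case True
    then show ?thesis
      using sum_subset_weight[OF assms(1), of "1::real"] by simp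
  next
    case False
    then have "\<not> (\<forall>i\<in>I. \<not> f i \<subseteq> W)" for W
      using fe by blast
    then show ?thesis
      using 0(4)[of "{}"] by (simp del: ball_simps bex_simps)
  qed
next
  case (Suc j)
  note fin = assms(1) Suc.prems(1)
  have N: "0 \<le> N"
    using Suc.prems(4)[of "{}"] by simp
  obtain T where Tf: "\<And>W i. i \<in> I \<Longrightarrow> \<exists>i'\<in>I. T W i = f i' - W"
    and Tsub: "\<And>W i. i \<in> I \<Longrightarrow> T W i \<subseteq> f i"
    and Tmin: "\<And>W i i'. i \<in> I \<Longrightarrow> i' \<in> I \<Longrightarrow> f i' \<subseteq> W \<union> T W i \<Longrightarrow> T W i \<subseteq> f i'"
  proof -
    define good where "good W i T \<longleftrightarrow> (\<exists>i'\<in>I. T = f i' - W) \<and> T \<subseteq> f i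
        \<and> (\<forall>i'\<in>I. f i' \<subseteq> W \<union> T \<longrightarrow> T \<subseteq> f i')" for W i T
    have "good W i (SOME T. good W i T)" if "i \<in> I" for W i
      using minimal_fragment_exists[OF fin(2) that] unfolding good_def by (rule someI_ex)
    then show ?thesis
      by (intro that[of "\<lambda>W i. SOME T. good W i T"]) (simp_all add: good_def)
  qed
  let ?miss = "\<lambda>W. of_bool (\<forall>i\<in>I. \<not> f i \<subseteq> W) :: real"
  let ?J = "\<lambda>W. {i\<in>I. card (T W i) < 2 ^ j}"
  let ?L = "\<lambda>W. {i\<in>I. 2 ^ j \<le> card (T W i)}"
  let ?e = "(1 - (1 / 2) ^ j) / 2 :: real"
  \<comment> \<open>Once \<open>W\<close> is fixed, missing every member with
    \<open>W \<union> W'\<close> forces \<open>W'\<close> to miss every fragment. The induction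
    hypothesis is applied to the small fragments; the discarded indices \<open>?L W\<close> enlarge
    the deficit.\<close>
  have step: "N * (\<Sum>W'\<in>Pow V. subset_weight (s ^ j) V W' * ?miss (W \<union> W'))
      \<le> (N - real (card I) + N * ?e) + real (card (?L W))" for W
  proof -
    have "(\<Sum>W'\<in>Pow V. subset_weight (s ^ j) V W' * ?miss (W \<union> W'))
        \<le> (\<Sum>W'\<in>Pow V. subset_weight (s ^ j) V W' * of_bool (\<forall>i\<in>?J W. \<not> T W i \<subseteq> W'))"
    proof (intro sum_mono mult_left_mono)
      fix W'
      have "\<forall>i\<in>?J W. \<not> T W i \<subseteq> W'" if "\<forall>i\<in>I. \<not> f i \<subseteq> W \<union> W'"
        using that Tf[of _ W] by blast
      then show "?miss (W \<union> W') \<le> of_bool (\<forall>i\<in>?J W. \<not> T W i \<subseteq> W')"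
        by (simp add: of_bool_def)
    qed (use assms(5,6) in \<open>auto intro!: subset_weight_nonneg power_le_one\<close>)
    then have "N * (\<Sum>W'\<in>Pow V. subset_weight (s ^ j) V W' * ?miss (W \<union> W'))
        \<le> N * (\<Sum>W'\<in>Pow V. subset_weight (s ^ j) V W' * of_bool (\<forall>i\<in>?J W. \<not> T W i \<subseteq> W'))"
      using N by (rule mult_left_mono)
    also have "\<dots> \<le> N - real (card (?J W)) + N * ?e"
    proof (rule Suc.IH)
      show "finite (?J W)" using fin by simp
      show "T W i \<subseteq> V" "card (T W i) < 2 ^ j" if "i \<in> ?J W" for i
        using that Tsub[of i W] Suc.prems(2)[of i] by auto
      fix X assume X: "X \<subseteq> V"
      \<comment> \<open>Fragments shrink members, so superset counts do not grow. Counting indices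
        rather than sets keeps the multiplicity of fragments shared by several members.\<close>
      have "card {i\<in>?J W. X \<subseteq> T W i} \<le> card {i\<in>I. X \<subseteq> f i}"
        using fin Tsub by (intro card_mono) fastforce+
      then have "real (card {i\<in>?J W. X \<subseteq> T W i}) * R ^ card X
          \<le> real (card {i\<in>I. X \<subseteq> f i}) * R ^ card X"
        using assms(7) by (intro mult_right_mono) auto
      then show "real (card {i\<in>?J W. X \<subseteq> T W i}) * R ^ card X \<le> N"
        using Suc.prems(4)[OF X] by linarith
    qed
    also have "card I = card (?J W \<union> ?L W)"
      by (intro arg_cong[where f = card]) auto
    then have "card I = card (?J W) + card (?L W)"
      using fin by (subst (asm) card_Un_disjoint) auto
    then have "N - real (card (?J W)) + N * ?e = (N - real (card I) + N * ?e) + real (card (?L W))"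
      by simp
    finally show ?thesis .
  qed
  have "N * (\<Sum>W\<in>Pow V. subset_weight (s ^ Suc j) V W * ?miss W)
      = (\<Sum>W\<in>Pow V. subset_weight s V W *
          (N * (\<Sum>W'\<in>Pow V. subset_weight (s ^ j) V W' * ?miss (W \<union> W'))))"
    unfolding power_Suc subset_weight_convolution[OF fin(1), symmetric]
    by (simp add: sum_distrib_left mult_ac)
  also have "\<dots> \<le> (\<Sum>W\<in>Pow V. subset_weight s V W *
      ((N - real (card I) + N * ?e) + real (card (?L W))))"
    using step assms(5,6) by (intro sum_mono mult_left_mono subset_weight_nonneg) auto
  also have "\<dots> = (N - real (card I) + N * ?e)
      + (\<Sum>W\<in>Pow V. subset_weight s V W * real (card (?L W)))"
    unfolding distrib_left[of "subset_weight _ _ _"] sum.distrib sum_distrib_right[symmetric]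
      sum_subset_weight[OF fin(1)] by simp
  also have "(\<Sum>W\<in>Pow V. subset_weight s V W * real (card (?L W)))
      \<le> N * (2 ^ 2 ^ Suc j * (1 / 64) ^ 2 ^ j)"
    using fin Suc.prems assms(5-8) Tf Tsub Tmin
    by (intro sum_large_fragments_le[where f = f and R = R]) (auto intro: less_imp_le)
  \<comment> \<open>Here \<open>b = 2 ^ Suc j\<close> and \<open>d = 2 ^ j\<close>: the constant 64
    beats the \<open>4 ^ 2 ^ j\<close> choices of a fragment. The remaining loss is at most
    \<open>(1 / 2) ^ (j + 2)\<close>, exactly the growth of \<open>?e\<close> from \<open>j\<close>
    to \<open>Suc j\<close>.\<close>
  also have "(2::real) ^ 2 ^ Suc j * (1 / 64) ^ 2 ^ j = (1 / 2) ^ (4 * 2 ^ j)"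
  proof -
    have "(2::real) ^ 2 ^ Suc j = 4 ^ 2 ^ j"
      by (simp add: power_mult)
    moreover have "(1 / 2 :: real) ^ (4 * 2 ^ j) = (1 / 16) ^ 2 ^ j"
      unfolding power_mult by (simp add: power_divide)
    moreover have "(4::real) ^ 2 ^ j * (1 / 64) ^ 2 ^ j = (1 / 16) ^ 2 ^ j"
      unfolding power_mult_distrib[symmetric] by simp
    ultimately show ?thesis by simp
  qed
  also have "N * (1 / 2) ^ (4 * 2 ^ j) \<le> N * (1 / 2) ^ (j + 2)"
  proof -
    have "j < 2 ^ j" by (rule less_exp)
    then have "j + 2 \<le> 4 * 2 ^ j" by linarith
    then show ?thesis using N by (intro mult_left_mono power_decreasing) auto
  qed
  also have "(N - real (card I) + N * ?e) + N * (1 / 2) ^ (j + 2)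
      = N - real (card I) + N * ((1 - (1 / 2) ^ Suc j) / 2)"
    by (simp add: field_simps)
  finally show ?case by simp
qed

section \<open>Disjoint members of spread families\<close>

text \<open>A uniform random set is a union of \<open>m\<close> independent sets with omission
  probability \<open>s\<close>, where \<open>s ^ m = 1 / 2\<close>. The fragment bound with
  \<open>N = card \<G>\<close> starts without deficit and gives a miss probability below
  1/2.\<close>

lemma spread_family_misses_few:
  fixes \<G> :: "'a set set"
  assumes V: "finite V" and G: "\<G> \<subseteq> Pow V" "\<G> \<noteq> {}" and k: "1 \<le> k" "\<And>A. A \<in> \<G> \<Longrightarrow> card A \<le> k"
    and R: "2 ^ 7 * log 2 (2 * real k) \<le> R"
    and spr: "\<And>X. X \<subseteq> V \<Longrightarrow> real (card {A\<in>\<G>. X \<subseteq> A}) * R ^ card X \<le> real (card \<G>)"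
  shows "2 * card {W\<in>Pow V. \<forall>A\<in>\<G>. \<not> A \<subseteq> W} < 2 ^ card V"
proof -
  \<comment> \<open>The least \<open>m\<close> with \<open>k < 2 ^ m\<close>, the number of halvings
    of the size bound.\<close>
  define m where "m = Suc (nat \<lfloor>log 2 (real k)\<rfloor>)"
  have l0: "0 \<le> log 2 (real k)"
    using k by simp
  have m_le: "real m \<le> log 2 (2 * real k)"
    using l0 k by (simp add: m_def log_mult)
  have "log 2 (real k) < real m"
    using l0 unfolding m_def by linarith
  then have "real k < 2 powr real m"
    using k by (subst (asm) log_less_iff) auto
  then have km: "k < 2 ^ m"
    by (simp add: powr_realpow flip: of_nat_less_iff)
  have m0: "m > 0" by (simp add: m_def)
  define s where "s = root m (1 / 2)"
  have sm: "s ^ m = 1 / 2"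
    using m0 by (simp add: s_def)
  have s0: "0 < s"
    using m0 by (simp add: s_def)
  \<comment> \<open>Bernoulli's inequality: \<open>(1 - 1 / (2 * m)) ^ m\<close> is at least 1/2, so
    a larger \<open>s\<close> would have too large an \<open>m\<close>-th power.\<close>
  have s_le: "s \<le> 1 - 1 / (2 * real m)"
  proof (rule ccontr)
    assume "\<not> ?thesis"
    then have "(1 - 1 / (2 * real m)) ^ m < s ^ m"
      using m0 by (intro power_strict_mono) (auto simp: field_simps)
    moreover have "1 + real m * (- (1 / (2 * real m))) \<le> (1 + (- (1 / (2 * real m)))) ^ m"
      using m0 by (intro Bernoulli_inequality) (auto simp: field_simps)
    ultimately show False
      using m0 sm by simp
  qed
  have s1: "s < 1"
    using s_le m0 by (smt (verit) divide_pos_pos of_nat_0_less_iff)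
  have R_ge: "2 ^ 7 * real m \<le> R"
    using R m_le by simp
  have R0: "0 < R"
    by (rule less_le_trans[OF _ R_ge]) (use m0 in simp)
  \<comment> \<open>The factor \<open>2 ^ 7\<close> is 64 times the 2 in
    \<open>1 - s \<ge> 1 / (2 * m)\<close>.\<close>
  have sR: "64 * s \<le> R * (1 - s)"
  proof -
    have "64 * s \<le> 64" using s1 by simp
    also have "64 = (2 ^ 7 * real m) * (1 / (2 * real m))" using m0 by simp
    also have "\<dots> \<le> R * (1 - s)"
      using R_ge s_le R0 by (intro mult_mono) auto
    finally show ?thesis .
  qed
  have fin: "finite \<G>"
    using G V finite_subset by blast
  have "real (card \<G>) * (\<Sum>W\<in>Pow V. subset_weight (s ^ m) V W * of_bool (\<forall>A\<in>\<G>. \<not> A \<subseteq> W))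
      \<le> real (card \<G>) - real (card \<G>) + real (card \<G>) * ((1 - (1 / 2) ^ m) / 2)"
    using V fin G km k s0 s1 R0 sR spr
    by (intro spread_miss_weight_le[where f = "\<lambda>A. A" and R = R])
      (auto intro: le_less_trans[OF _ km])
  then have "(\<Sum>W\<in>Pow V. subset_weight (s ^ m) V W * of_bool (\<forall>A\<in>\<G>. \<not> A \<subseteq> W))
      \<le> (1 - (1 / 2) ^ m) / 2"
    using fin G by (simp add: card_gt_0_iff)
  also have "\<dots> < 1 / 2" by simp
  also have "(\<Sum>W\<in>Pow V. subset_weight (s ^ m) V W * of_bool (\<forall>A\<in>\<G>. \<not> A \<subseteq> W))
      = (\<Sum>W\<in>Pow V. (1 / 2) ^ card V * of_bool (\<forall>A\<in>\<G>. \<not> A \<subseteq> W))"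
  proof (rule sum.cong[OF refl])
    fix W assume W: "W \<in> Pow V"
    have "card W + card (V - W) = card V"
      using W V by (metis PowD card_Diff_subset card_mono finite_subset le_add_diff_inverse)
    then have "subset_weight (s ^ m) V W = (1 / 2) ^ card V"
      by (simp add: subset_weight_def sm flip: power_add)
    then show "subset_weight (s ^ m) V W * of_bool (\<forall>A\<in>\<G>. \<not> A \<subseteq> W)
        = (1 / 2) ^ card V * of_bool (\<forall>A\<in>\<G>. \<not> A \<subseteq> W)" by simp
  qed
  also have "\<dots> = (1 / 2) ^ card V * real (card {W\<in>Pow V. \<forall>A\<in>\<G>. \<not> A \<subseteq> W})"
    using V by (simp add: Int_def flip: sum_distrib_left)
  finally have "real (2 * card {W\<in>Pow V. \<forall>A\<in>\<G>. \<not> A \<subseteq> W}) < real (2 ^ card V)"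
    by (simp add: power_divide field_simps)
  then show ?thesis
    by (simp only: of_nat_less_iff)
qed

text \<open>Fewer than half of the sets \<open>W\<close> miss \<open>\<G>\<close>, and for fewer
  than half does the complement miss \<open>\<H>\<close>. Some \<open>W\<close> does neither, and it
  separates the two members found.\<close>

lemma spread_families_disjoint_members:
  fixes \<G> \<H> :: "'a set set"
  assumes V: "finite V" and k: "1 \<le> k" and R: "2 ^ 7 * log 2 (2 * real k) \<le> R"
    and G: "\<G> \<subseteq> Pow V" "\<G> \<noteq> {}" "\<And>A. A \<in> \<G> \<Longrightarrow> card A \<le> k"
      "\<And>X. X \<subseteq> V \<Longrightarrow> real (card {A\<in>\<G>. X \<subseteq> A}) * R ^ card X \<le> real (card \<G>)"
    and H: "\<H> \<subseteq> Pow V" "\<H> \<noteq> {}" "\<And>A. A \<in> \<H> \<Longrightarrow> card A \<le> k"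
      "\<And>X. X \<subseteq> V \<Longrightarrow> real (card {A\<in>\<H>. X \<subseteq> A}) * R ^ card X \<le> real (card \<H>)"
  shows "\<exists>A\<in>\<G>. \<exists>B\<in>\<H>. A \<inter> B = {}"
proof -
  let ?M = "{W\<in>Pow V. \<forall>A\<in>\<G>. \<not> A \<subseteq> W}"
  let ?M' = "{W\<in>Pow V. \<forall>A\<in>\<H>. \<not> A \<subseteq> W}"
  have "2 * card ?M < 2 ^ card V" "2 * card ?M' < 2 ^ card V"
    using spread_family_misses_few[OF V G(1,2) k G(3) R G(4)]
      spread_family_misses_few[OF V H(1,2) k H(3) R H(4)] by auto
  moreover have "card ((\<lambda>W. V - W) ` ?M') \<le> card ?M'"
    using V by (intro card_image_le) auto
  moreover have "card (?M \<union> (\<lambda>W. V - W) ` ?M') \<le> card ?M + card ((\<lambda>W. V - W) ` ?M')"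
    by (rule card_Un_le)
  ultimately have "card (?M \<union> (\<lambda>W. V - W) ` ?M') < card (Pow V)"
    using V by (simp add: card_Pow)
  then have "\<not> Pow V \<subseteq> ?M \<union> (\<lambda>W. V - W) ` ?M'"
  proof -
    have "finite (?M \<union> (\<lambda>W. V - W) ` ?M')" using V by simp
    then show ?thesis
      using card_mono \<open>card _ < card (Pow V)\<close> by (meson linorder_not_less)
  qed
  then obtain W where W: "W \<subseteq> V" "W \<notin> ?M" "W \<notin> (\<lambda>W. V - W) ` ?M'"
    by blast
  have "V - W \<notin> ?M'"
    using W(1,3) by (metis (no_types, lifting) double_diff image_eqI order_refl)
  then obtain B where "B \<in> \<H>" "B \<subseteq> V - W" by auto
  moreover obtain A where "A \<in> \<G>" "A \<subseteq> W" using W by auto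
  ultimately show ?thesis by blast
qed

section \<open>Links and homogeneity\<close>

lemma link_eq_image: "link \<G> S = (\<lambda>A. A - S) ` {A\<in>\<G>. S \<subseteq> A}"
  by (auto simp: link_def)

lemma link_empty_set [simp]: "link \<G> {} = \<G>"
  by (auto simp: link_eq_image)

lemma link_mono: "\<G> \<subseteq> \<H> \<Longrightarrow> link \<G> S \<subseteq> link \<H> S"
  by (auto simp: link_eq_image)

text \<open>Removing \<open>S\<close> is injective on supersets of \<open>S\<close>; this translates
  spreadness of links into the superset counts used for fragments.\<close>

lemma card_link: "card (link \<G> S) = card {A\<in>\<G>. S \<subseteq> A}"
  unfolding link_eq_image by (intro card_image) (auto simp: inj_on_def)

lemma finite_link: "finite \<G> \<Longrightarrow> finite (link \<G> S)"
  by (simp add: link_eq_image)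

lemma link_link:
  assumes "X \<inter> S = {}"
  shows "link (link \<G> S) X = link \<G> (S \<union> X)"
proof
  show "link (link \<G> S) X \<subseteq> link \<G> (S \<union> X)"
  proof
    fix A assume "A \<in> link (link \<G> S) X"
    then obtain A' where A': "A' \<in> \<G>" "S \<subseteq> A'" "X \<subseteq> A' - S" "A = (A' - S) - X"
      by (auto simp: link_eq_image)
    then have "S \<union> X \<subseteq> A'" "A = A' - (S \<union> X)" by blast+
    then show "A \<in> link \<G> (S \<union> X)"
      using A'(1) unfolding link_def by blast
  qed
  show "link \<G> (S \<union> X) \<subseteq> link (link \<G> S) X"
  proof
    fix A assume "A \<in> link \<G> (S \<union> X)"
    then obtain A' where A': "A' \<in> \<G>" "S \<union> X \<subseteq> A'" "A = A' - (S \<union> X)"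
      by (auto simp: link_eq_image)
    then have "A' - S \<in> link \<G> S" "X \<subseteq> A' - S" "A = (A' - S) - X"
      using assms by (auto simp: link_eq_image)
    then show "A \<in> link (link \<G> S) X"
      unfolding link_def by blast
  qed
qed

lemma link_link_eq_empty: "X \<inter> S \<noteq> {} \<Longrightarrow> link (link \<G> S) X = {}"
  by (auto simp: link_def)

section \<open>Greedy extraction of homogeneous links\<close>

text \<open>For a maximal heavy \<open>S\<close>, the upper bound at the non-heavy set
  \<open>S \<union> X\<close> divided by the lower bound at \<open>S\<close> is homogeneity at
  \<open>X\<close>. Heaviness of \<open>S\<close> and
  \<open>card (link \<F> S) \<le> card (link \<A> S)\<close> give the size bound.\<close>

lemma homogeneous_link_exists:
  fixes \<A> \<F> :: "'a set set" and \<tau> :: real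
  assumes V: "finite V" "\<A> \<subseteq> Pow V" and F: "\<F> \<subseteq> \<A>" "\<F> \<noteq> {}" and \<tau>: "0 < \<tau>"
  shows "\<exists>S\<subseteq>V. homogeneous (link \<A> S) \<tau> (link \<F> S) \<and> real (card \<F>) * \<tau> ^ card S \<le> real (card \<A>)"
proof -
  have finA: "finite \<A>" and finF: "finite \<F>"
    using V F by (meson finite_Pow_iff finite_subset)+
  have pos: "0 < real (card \<F>)" "0 < real (card \<A>)"
    using F finA finF by (auto simp: card_gt_0_iff)
  \<comment> \<open>Without \<open>link \<A> S \<noteq> {}\<close>, sets contained in no member of
    \<open>\<A>\<close> would be heavy through \<open>0 \<le> 0\<close> and spoil
    maximality.\<close>
  define heavy where "heavy = {S\<in>Pow V. link \<A> S \<noteq> {} \<and>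
    real (card \<F>) * \<tau> ^ card S * real (card (link \<A> S)) \<le> real (card (link \<F> S)) * real (card \<A>)}"
  have "finite heavy" "heavy \<noteq> {}"
  proof -
    show "finite heavy" using V by (simp add: heavy_def)
    have "{} \<in> heavy" using F by (auto simp: heavy_def)
    then show "heavy \<noteq> {}" by blast
  qed
  from finite_has_maximal[OF this]
  obtain S where S: "S \<in> heavy" and max: "\<And>S'. S' \<in> heavy \<Longrightarrow> S \<subseteq> S' \<Longrightarrow> S = S'"
    by blast
  have SV: "S \<subseteq> V" and linkA: "link \<A> S \<noteq> {}"
    and ineq: "real (card \<F>) * \<tau> ^ card S * real (card (link \<A> S))
      \<le> real (card (link \<F> S)) * real (card \<A>)"
    using S by (auto simp: heavy_def)
  have a: "0 < real (card (link \<A> S))"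
    using linkA finA by (auto simp: card_gt_0_iff finite_link)
  have "0 < real (card \<F>) * \<tau> ^ card S * real (card (link \<A> S))"
    using pos \<tau> a by simp
  then have "0 < real (card (link \<F> S)) * real (card \<A>)"
    using ineq by linarith
  then have f: "0 < real (card (link \<F> S))"
    using pos by (simp add: zero_less_mult_iff)
  have "real (card (link (link \<F> S) X)) / real (card (link \<F> S))
      \<le> \<tau> ^ card X * (real (card (link (link \<A> S) X)) / real (card (link \<A> S)))" for X
  \<comment> \<open>For \<open>X = {}\<close> both sides are 1, and for an empty double link the
    left side is 0. Otherwise \<open>X\<close> is disjoint from \<open>S\<close> and
    \<open>S \<union> X\<close> is a strictly larger candidate.\<close>
  proof (cases "X = {} \<or> link (link \<F> S) X = {}")
    case True
    then show ?thesis using a f \<tau> by auto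
  next
    case False
    then have nonempty: "X \<noteq> {}" "link (link \<F> S) X \<noteq> {}"
      by simp_all
    then have disj: "X \<inter> S = {}"
      using link_link_eq_empty by metis
    have eq: "link (link \<G> S) X = link \<G> (S \<union> X)" for \<G>
      by (rule link_link[OF disj])
    have ne: "link \<F> (S \<union> X) \<noteq> {}" "link \<A> (S \<union> X) \<noteq> {}"
      using nonempty(2) eq[of \<F>] link_mono[OF F(1), of "S \<union> X"] by auto
    then obtain A where "A \<in> \<A>" "S \<union> X \<subseteq> A"
      unfolding link_def by blast
    then have XV: "S \<union> X \<subseteq> V"
      using V(2) by blast
    have "S \<union> X \<notin> heavy"
      using max[of "S \<union> X"] nonempty(1) disj by auto
    then have lt: "real (card (link \<F> (S \<union> X))) * real (card \<A>)
        \<le> real (card \<F>) * \<tau> ^ card (S \<union> X) * real (card (link \<A> (S \<union> X)))"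
      using ne XV by (auto simp: heavy_def)
    have card: "card (S \<union> X) = card S + card X"
      using XV V(1) disj by (intro card_Un_disjoint) (auto intro: finite_subset)
    have "(real (card (link \<F> (S \<union> X))) * real (card (link \<A> S))) * real (card \<A>)
        = (real (card (link \<F> (S \<union> X))) * real (card \<A>)) * real (card (link \<A> S))"
      by simp
    also have "\<dots> \<le> (real (card \<F>) * \<tau> ^ card (S \<union> X) * real (card (link \<A> (S \<union> X))))
        * real (card (link \<A> S))"
      using lt by (rule mult_right_mono) simp
    also have "\<dots> = (real (card \<F>) * \<tau> ^ card S * real (card (link \<A> S)))
        * (\<tau> ^ card X * real (card (link \<A> (S \<union> X))))"
      by (simp add: card power_add)
    also have "\<dots> \<le> (real (card (link \<F> S)) * real (card \<A>))
        * (\<tau> ^ card X * real (card (link \<A> (S \<union> X))))"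
      using ineq \<tau> by (intro mult_right_mono) auto
    also have "\<dots> = (\<tau> ^ card X * real (card (link \<A> (S \<union> X))) * real (card (link \<F> S)))
        * real (card \<A>)"
      by simp
    finally have "real (card (link \<F> (S \<union> X))) * real (card (link \<A> S))
        \<le> \<tau> ^ card X * real (card (link \<A> (S \<union> X))) * real (card (link \<F> S))"
      using pos(2) by (simp only: mult_le_cancel_right_pos)
    then show ?thesis
      unfolding eq using a f by (simp add: field_simps)
  qed
  moreover have "link \<F> S \<noteq> {}" using f by auto
  ultimately have "homogeneous (link \<A> S) \<tau> (link \<F> S)"
    unfolding homogeneous_def using link_mono[OF F(1)] by blast
  moreover have "real (card \<F>) * \<tau> ^ card S \<le> real (card \<A>)"
  proof -
    have "card (link \<F> S) \<le> card (link \<A> S)"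
      using finA F(1) by (intro card_mono finite_link link_mono)
    then have "real (card (link \<F> S)) * real (card \<A>) \<le> real (card \<A>) * real (card (link \<A> S))"
      by (simp add: mult.commute mult_left_mono)
    with ineq have "(real (card \<F>) * \<tau> ^ card S) * real (card (link \<A> S))
        \<le> real (card \<A>) * real (card (link \<A> S))"
      by linarith
    then show ?thesis using a by (simp only: mult_le_cancel_right_pos)
  qed
  ultimately show ?thesis using SV by blast
qed

text \<open>Induction on the size of the remaining family. Each \<open>\<F>\<^sub>B\<close> is what
  remained when \<open>B\<close> was recorded, hence a subfamily of every earlier remainder.\<close>

lemma homogeneous_peeling:
  fixes \<A> \<F> :: "'a set set" and \<tau> :: real
  assumes V: "finite V" "\<A> \<subseteq> Pow V" and \<tau>: "1 \<le> \<tau>" and F: "\<F> \<subseteq> \<A>"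
  shows "\<exists>\<S> \<F>'. (\<forall>B\<in>\<S>. B \<subseteq> V \<and> card B \<le> q \<and>
        (\<exists>\<F>\<^sub>B. \<F>\<^sub>B \<subseteq> \<F> \<and> homogeneous (link \<A> B) \<tau> (link \<F>\<^sub>B B)))
      \<and> \<F>' \<subseteq> \<F> \<and> (\<forall>A\<in>\<F> - \<F>'. \<exists>B\<in>\<S>. B \<subseteq> A) \<and> real (card \<F>') * \<tau> ^ (q + 1) \<le> real (card \<A>)"
  using F
proof (induction "card \<F>" arbitrary: \<F> rule: less_induct)
  case less
  have finF: "finite \<F>"
    using V less.prems by (meson finite_Pow_iff finite_subset)
  show ?case
  proof (cases "\<F> = {}")
    case True
    then show ?thesis by (intro exI[of _ "{}"]) simp
  next
    case False
    obtain S where S: "S \<subseteq> V" "homogeneous (link \<A> S) \<tau> (link \<F> S)"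
      "real (card \<F>) * \<tau> ^ card S \<le> real (card \<A>)"
      using homogeneous_link_exists[OF V less.prems False, of \<tau>] \<tau> by auto
    show ?thesis
    proof (cases "card S \<le> q")
      case False
      \<comment> \<open>As \<open>card S \<ge> q + 1\<close>, the size bound from \<open>S\<close>
        makes the whole remainder small enough to be \<open>\<F>'\<close>.\<close>
      then have "real (card \<F>) * \<tau> ^ (q + 1) \<le> real (card \<F>) * \<tau> ^ card S"
        using \<tau> by (intro mult_left_mono power_increasing) auto
      then have "real (card \<F>) * \<tau> ^ (q + 1) \<le> real (card \<A>)"
        using S(3) by linarith
      then show ?thesis by - (rule exI[of _ "{}"], rule exI[of _ \<F>], simp)
    next
      case True
      let ?F2 = "{A\<in>\<F>. \<not> S \<subseteq> A}"
      \<comment> \<open>Nonemptiness, part of homogeneity, makes the deletion proper, so the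
        recursion terminates.\<close>
      have "link \<F> S \<noteq> {}"
        using S(2) by (simp add: homogeneous_def)
      then have "?F2 \<subset> \<F>" by (auto simp: link_def)
      then have "card ?F2 < card \<F>"
        using finF by (rule psubset_card_mono[rotated])
      moreover have "?F2 \<subseteq> \<A>" using less.prems by blast
      ultimately have "\<exists>\<S> \<F>'. (\<forall>B\<in>\<S>. B \<subseteq> V \<and> card B \<le> q \<and>
          (\<exists>\<F>\<^sub>B. \<F>\<^sub>B \<subseteq> ?F2 \<and> homogeneous (link \<A> B) \<tau> (link \<F>\<^sub>B B)))
        \<and> \<F>' \<subseteq> ?F2 \<and> (\<forall>A\<in>?F2 - \<F>'. \<exists>B\<in>\<S>. B \<subseteq> A)
        \<and> real (card \<F>') * \<tau> ^ (q + 1) \<le> real (card \<A>)"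
        by (rule less.hyps)
      then obtain \<S> \<F>' where IH:
        "\<forall>B\<in>\<S>. B \<subseteq> V \<and> card B \<le> q \<and> (\<exists>\<F>\<^sub>B. \<F>\<^sub>B \<subseteq> ?F2 \<and> homogeneous (link \<A> B) \<tau> (link \<F>\<^sub>B B))"
        "\<F>' \<subseteq> ?F2" "\<forall>A\<in>?F2 - \<F>'. \<exists>B\<in>\<S>. B \<subseteq> A" "real (card \<F>') * \<tau> ^ (q + 1) \<le> real (card \<A>)"
        by (elim exE conjE)
      have "\<exists>\<F>\<^sub>B. \<F>\<^sub>B \<subseteq> \<F> \<and> homogeneous (link \<A> B) \<tau> (link \<F>\<^sub>B B)" if "B \<in> insert S \<S>" for B
      proof (cases "B = S")
        case True
        then show ?thesis using S(2) by blast
      next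
        case False
        then have "B \<in> \<S>" using that by blast
        then obtain \<F>\<^sub>B where "\<F>\<^sub>B \<subseteq> ?F2" "homogeneous (link \<A> B) \<tau> (link \<F>\<^sub>B B)"
          using IH(1) by blast
        then show ?thesis by blast
      qed
      moreover have "\<forall>B\<in>insert S \<S>. B \<subseteq> V \<and> card B \<le> q"
        using IH(1) S(1) True by simp
      moreover have "\<forall>A\<in>\<F> - \<F>'. \<exists>B\<in>insert S \<S>. B \<subseteq> A"
        using IH(3) by auto
      moreover have "\<F>' \<subseteq> \<F>"
        using IH(2) by blast
      ultimately show ?thesis
        using IH(4) by - (rule exI[of _ "insert S \<S>"], rule exI[of _ \<F>'], simp)
    qed
  qed
qed

section \<open>From homogeneity to members with prescribed intersection\<close>

text \<open>Homogeneity loses a factor \<tau> per point against the spreadness \<open>r\<close> of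
  \<open>\<B>\<close>, which leaves \<open>r / \<tau>\<close>.\<close>

lemma homogeneous_card_supersets_le:
  fixes r \<tau> :: real
  assumes hom: "homogeneous \<B> \<tau> \<G>" and spr: "spread r \<B>" and fin: "finite \<B>" and pos: "0 < r" "0 < \<tau>"
  shows "real (card {A\<in>\<G>. X \<subseteq> A}) * (r / \<tau>) ^ card X \<le> real (card \<G>)"
proof -
  have G: "\<G> \<subseteq> \<B>" "\<G> \<noteq> {}"
    and h: "real (card (link \<G> X)) / real (card \<G>)
      \<le> \<tau> ^ card X * (real (card (link \<B> X)) / real (card \<B>))"
    using hom by (auto simp: homogeneous_def)
  have cpos: "0 < real (card \<G>)" "0 < real (card \<B>)"
    using G fin finite_subset by (auto simp: card_gt_0_iff)
  have "real (card (link \<B> X)) \<le> r powi (- int (card X)) * real (card \<B>)"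
    using spr by (simp add: spread_def)
  then have "real (card (link \<B> X)) / real (card \<B>) \<le> 1 / r ^ card X"
    using cpos by (simp add: power_int_minus field_simps)
  then have "\<tau> ^ card X * (real (card (link \<B> X)) / real (card \<B>)) \<le> \<tau> ^ card X * (1 / r ^ card X)"
    using pos by (intro mult_left_mono) auto
  with h have "real (card (link \<G> X)) / real (card \<G>) \<le> \<tau> ^ card X / r ^ card X"
    by simp
  then show ?thesis
    using cpos pos by (simp add: card_link power_divide field_simps)
qed

text \<open>Each point lies in at most a \<open>1 / r\<close> fraction of the members, so avoiding
  \<open>D\<close> costs at most half of them. Relative densities at most double, and halving
  \<open>r\<close> pays for this when \<open>X\<close> is nonempty.\<close>

lemma spread_avoiding_subfamily:
  fixes \<L> :: "'a set set" and r :: real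
  assumes fin: "finite \<L>" "finite D" and r: "2 * real (card D) \<le> r" "0 < r"
    and spr: "\<And>X. real (card {A\<in>\<L>. X \<subseteq> A}) * r ^ card X \<le> real (card \<L>)"
  defines "\<G> \<equiv> {A\<in>\<L>. A \<inter> D = {}}"
  shows "real (card \<L>) \<le> 2 * real (card \<G>)"
    and "real (card {A\<in>\<G>. X \<subseteq> A}) * (r / 2) ^ card X \<le> real (card \<G>)"
proof -
  have "real (card (\<L> - \<G>)) \<le> real (card (\<Union>x\<in>D. {A\<in>\<L>. {x} \<subseteq> A}))"
    using fin by (intro of_nat_mono card_mono) (auto simp: \<G>_def)
  also have "\<dots> \<le> (\<Sum>x\<in>D. real (card {A\<in>\<L>. {x} \<subseteq> A}))"
    using card_UN_le[OF fin(2), of "\<lambda>x. {A\<in>\<L>. {x} \<subseteq> A}"]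
    by (simp only: of_nat_sum[symmetric] of_nat_le_iff)
  also have "\<dots> \<le> (\<Sum>x\<in>D. real (card \<L>) / r)"
  proof (rule sum_mono)
    fix x
    show "real (card {A\<in>\<L>. {x} \<subseteq> A}) \<le> real (card \<L>) / r"
      using spr[of "{x}"] r(2) by (simp add: field_simps)
  qed
  also have "\<dots> = real (card D) / r * real (card \<L>)"
    by simp
  also have "\<dots> \<le> 1 / 2 * real (card \<L>)"
    using r by (intro mult_right_mono) (auto simp: field_simps)
  finally have "real (card (\<L> - \<G>)) \<le> 1 / 2 * real (card \<L>)" .
  moreover have "card \<L> = card \<G> + card (\<L> - \<G>)"
    using fin card_Diff_subset[of \<G> \<L>] card_mono[of \<L> \<G>] by (auto simp: \<G>_def)
  ultimately show half: "real (card \<L>) \<le> 2 * real (card \<G>)"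
    by simp
  show "real (card {A\<in>\<G>. X \<subseteq> A}) * (r / 2) ^ card X \<le> real (card \<G>)"
  \<comment> \<open>This case includes infinite \<open>X\<close>, whose \<open>card\<close> is 0;
    monotonicity of \<open>card\<close> suffices.\<close>
  proof (cases "card X = 0")
    case True
    have "card {A\<in>\<G>. X \<subseteq> A} \<le> card \<G>"
      using fin by (intro card_mono) (auto simp: \<G>_def)
    then show ?thesis using True by simp
  next
    case False
    have "card {A\<in>\<G>. X \<subseteq> A} \<le> card {A\<in>\<L>. X \<subseteq> A}"
      using fin by (intro card_mono) (auto simp: \<G>_def)
    then have "real (card {A\<in>\<G>. X \<subseteq> A}) * r ^ card X \<le> real (card {A\<in>\<L>. X \<subseteq> A}) * r ^ card X"
      using r by (intro mult_right_mono) auto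
    also have "\<dots> \<le> 2 * real (card \<G>)"
      using spr[of X] half by linarith
    also have "\<dots> \<le> 2 ^ card X * real (card \<G>)"
      using False power_increasing[of 1 "card X" "2::real"] by (intro mult_right_mono) auto
    finally show ?thesis
      by (simp add: power_divide field_simps)
  qed
qed

text \<open>Choose \<open>A\<^sub>1 - B\<close> avoiding \<open>C\<close>,
  \<open>A\<^sub>2 - C\<close> avoiding \<open>B\<close>, and the two disjoint: only
  \<open>B \<inter> C\<close> is left in common. This carries intersection sizes in
  \<open>\<F>\<close> over to the recorded sets.\<close>

lemma homogeneous_links_meet_exactly:
  fixes \<A> \<F>\<^sub>1 \<F>\<^sub>2 :: "nat set set" and \<tau> r\<^sub>0 :: real
  assumes k: "1 \<le> k" "\<forall>A\<in>\<A>. card A \<le> k" and \<tau>: "1 \<le> \<tau>"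
    and spr: "rq_spread n r\<^sub>0 q \<A>"
    and r: "2 * \<tau> * real q \<le> r\<^sub>0" "2 ^ 12 * \<tau> * log 2 (2 * real k) < r\<^sub>0"
    and B: "B \<subseteq> {1..n}" "card B \<le> q" "homogeneous (link \<A> B) \<tau> (link \<F>\<^sub>1 B)" "\<F>\<^sub>1 \<subseteq> \<A>"
    and C: "C \<subseteq> {1..n}" "card C \<le> q" "homogeneous (link \<A> C) \<tau> (link \<F>\<^sub>2 C)" "\<F>\<^sub>2 \<subseteq> \<A>"
  shows "\<exists>A\<^sub>1\<in>\<F>\<^sub>1. \<exists>A\<^sub>2\<in>\<F>\<^sub>2. A\<^sub>1 \<inter> A\<^sub>2 = B \<inter> C"
proof -
  let ?V = "{1..n}"
  \<comment> \<open>One division by \<tau> for homogeneity, one by 2 for avoiding the other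
    set.\<close>
  let ?R = "r\<^sub>0 / \<tau> / 2"
  have A: "\<A> \<subseteq> Pow ?V" and sprA: "\<And>S. S \<subseteq> ?V \<Longrightarrow> card S \<le> q \<Longrightarrow> spread r\<^sub>0 (link \<A> S)"
    using spr by (auto simp: rq_spread_def)
  have finA: "finite \<A>"
    using A by (rule finite_subset) simp
  have lk: "1 \<le> log 2 (2 * real k)"
    using k by (simp add: log_mult)
  have "0 < 2 ^ 12 * \<tau> * log 2 (2 * real k)"
    using \<tau> lk by simp
  then have r0: "0 < r\<^sub>0" using r by linarith
  have "2 ^ 11 * log 2 (2 * real k) \<le> ?R"
    using r(2) \<tau> by (simp add: field_simps)
  then have R: "2 ^ 7 * log 2 (2 * real k) \<le> ?R"
    using lk by simp
  have rq: "2 * real q \<le> r\<^sub>0 / \<tau>"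
    using r(1) \<tau> by (simp add: field_simps)
  \<comment> \<open>Proved for a generic pair \<open>S\<close>, \<open>S'\<close> because it is used
    in both orders of \<open>B\<close> and \<open>C\<close>.\<close>
  have fam: "\<G> \<subseteq> Pow ?V \<and> \<G> \<noteq> {} \<and> (\<forall>A\<in>\<G>. card A \<le> k)
      \<and> (\<forall>X. real (card {A\<in>\<G>. X \<subseteq> A}) * ?R ^ card X \<le> real (card \<G>))"
    if S: "S \<subseteq> ?V" "card S \<le> q" "homogeneous (link \<A> S) \<tau> (link \<F>\<^sub>S S)" "\<F>\<^sub>S \<subseteq> \<A>"
      and S': "S' \<subseteq> ?V" "card S' \<le> q"
      and G: "\<G> = {A\<in>link \<F>\<^sub>S S. A \<inter> (S' - S) = {}}" for \<G> \<F>\<^sub>S S S'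
  proof -
    let ?L = "link \<F>\<^sub>S S"
    have L: "finite ?L" "?L \<noteq> {}"
      using S(3,4) finA by (auto simp: homogeneous_def intro: finite_link finite_subset)
    have D: "finite (S' - S)" "card (S' - S) \<le> q"
    proof -
      have "finite S'" using S'(1) by (rule finite_subset) simp
      then show "finite (S' - S)" "card (S' - S) \<le> q"
        using S'(2) card_mono[of S' "S' - S"] by auto
    qed
    have Lspr: "real (card {A\<in>?L. X \<subseteq> A}) * (r\<^sub>0 / \<tau>) ^ card X \<le> real (card ?L)" for X
      using S \<tau> r0 finA by (intro homogeneous_card_supersets_le[OF S(3) sprA]) (auto intro: finite_link)
    have rD: "2 * real (card (S' - S)) \<le> r\<^sub>0 / \<tau>" "0 < r\<^sub>0 / \<tau>"
      using D(2) rq r0 \<tau> by auto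
    note avoid = spread_avoiding_subfamily[OF L(1) D(1) rD Lspr, folded G]
    have "0 < card ?L" using L by (simp add: card_gt_0_iff)
    then have "\<G> \<noteq> {}" using avoid(1) by auto
    moreover have "A \<subseteq> ?V \<and> card A \<le> k" if AG: "A \<in> \<G>" for A
    proof -
      obtain A' where A': "A' \<in> \<A>" "A = A' - S"
        using AG S(4) unfolding G link_def by blast
      have "A' \<subseteq> ?V" using A' A by blast
      moreover from this have "finite A'" by (rule finite_subset) simp
      then have "card A \<le> card A'" using A' by (intro card_mono) auto
      ultimately show ?thesis using A' k(2) by force
    qed
    ultimately show ?thesis using avoid(2) by blast
  qed
  define \<G> where "\<G> = {A\<in>link \<F>\<^sub>1 B. A \<inter> (C - B) = {}}"
  define \<H> where "\<H> = {A\<in>link \<F>\<^sub>2 C. A \<inter> (B - C) = {}}"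
  have "\<exists>A\<in>\<G>. \<exists>A'\<in>\<H>. A \<inter> A' = {}"
    using fam[OF B C(1,2) \<G>_def] fam[OF C B(1,2) \<H>_def] k(1) R
    by (intro spread_families_disjoint_members[of ?V k ?R]) auto
  then obtain A\<^sub>1 A\<^sub>2 where
    "A\<^sub>1 \<in> \<F>\<^sub>1" "B \<subseteq> A\<^sub>1" "(A\<^sub>1 - B) \<inter> (C - B) = {}"
    "A\<^sub>2 \<in> \<F>\<^sub>2" "C \<subseteq> A\<^sub>2" "(A\<^sub>2 - C) \<inter> (B - C) = {}" "(A\<^sub>1 - B) \<inter> (A\<^sub>2 - C) = {}"
    unfolding \<G>_def \<H>_def link_def by blast
  moreover from this have "A\<^sub>1 \<inter> A\<^sub>2 = B \<inter> C" by blast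
  ultimately show ?thesis by blast
qed

theorem theorem6:
  fixes n k t q :: nat and \<tau> r\<^sub>0 :: real and \<A> \<F> :: "nat set set"
  assumes "n \<ge> 1" and "k \<ge> 1" and "t \<ge> 1"
    and "\<A> \<subseteq> Pow {1..n}"
    and "\<forall>A\<in>\<A>. card A \<le> k"
    and "\<F> \<subseteq> \<A>"
    and "t_intersecting t \<F>"
    and "q \<ge> 1" and "\<tau> \<ge> 1"
    and "rq_spread n r\<^sub>0 q \<A>"
    and "r\<^sub>0 \<ge> 2 * \<tau> * real q"
    and "r\<^sub>0 > 2 ^ 12 * \<tau> * log 2 (2 * real k)"
  shows "\<exists>\<S> \<F>'.
      t_intersecting t \<S> \<and> (\<forall>B\<in>\<S>. B \<subseteq> {1..n} \<and> card B \<le> q) \<and> \<F>' \<subseteq> \<F> \<and>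
      (\<forall>A\<in>\<F> - \<F>'. \<exists>B\<in>\<S>. B \<subseteq> A) \<and>
      (\<forall>B\<in>\<S>. \<exists>\<F>\<^sub>B. \<F>\<^sub>B \<subseteq> \<F> \<and> homogeneous (link \<A> B) \<tau> (link \<F>\<^sub>B B)) \<and>
      real (card \<F>') \<le> \<tau> powi (- int q - 1) * real (card \<A>)"
proof -
  have "finite {1..n}" by simp
  from homogeneous_peeling[OF this assms(4,9,6), of q]
  obtain \<S> \<F>' where peel: "\<forall>B\<in>\<S>. B \<subseteq> {1..n} \<and> card B \<le> q \<and>
        (\<exists>\<F>\<^sub>B. \<F>\<^sub>B \<subseteq> \<F> \<and> homogeneous (link \<A> B) \<tau> (link \<F>\<^sub>B B))"
    and F': "\<F>' \<subseteq> \<F>" "\<forall>A\<in>\<F> - \<F>'. \<exists>B\<in>\<S>. B \<subseteq> A" "real (card \<F>') * \<tau> ^ (q + 1) \<le> real (card \<A>)"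
    by (elim exE conjE)
  have S: "B \<subseteq> {1..n} \<and> card B \<le> q"
      "\<exists>\<F>\<^sub>B. \<F>\<^sub>B \<subseteq> \<F> \<and> homogeneous (link \<A> B) \<tau> (link \<F>\<^sub>B B)" if "B \<in> \<S>" for B
    using bspec[OF peel that] by simp_all
  \<comment> \<open>The case \<open>B = C\<close> is included and yields
    \<open>t \<le> card B\<close>.\<close>
  have "t \<le> card (B \<inter> C)" if BC: "B \<in> \<S>" "C \<in> \<S>" for B C
  proof -
    obtain \<F>\<^sub>1 \<F>\<^sub>2 where hom: "\<F>\<^sub>1 \<subseteq> \<F>" "homogeneous (link \<A> B) \<tau> (link \<F>\<^sub>1 B)"
      "\<F>\<^sub>2 \<subseteq> \<F>" "homogeneous (link \<A> C) \<tau> (link \<F>\<^sub>2 C)"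
      using S(2) BC by meson
    have "\<exists>A\<^sub>1\<in>\<F>\<^sub>1. \<exists>A\<^sub>2\<in>\<F>\<^sub>2. A\<^sub>1 \<inter> A\<^sub>2 = B \<inter> C"
      using assms hom S(1) BC
      by (intro homogeneous_links_meet_exactly[of k \<A> \<tau> n r\<^sub>0 q]) auto
    then obtain A\<^sub>1 A\<^sub>2 where "A\<^sub>1 \<in> \<F>" "A\<^sub>2 \<in> \<F>" "A\<^sub>1 \<inter> A\<^sub>2 = B \<inter> C"
      using hom by blast
    then show ?thesis
      using assms(7) unfolding t_intersecting_def by metis
  qed
  then have "t_intersecting t \<S>"
    by (simp add: t_intersecting_def)
  moreover have "real (card \<F>') \<le> \<tau> powi (- int q - 1) * real (card \<A>)"
  proof -
    have "- int q - 1 = - int (q + 1)" by simp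
    then have "\<tau> powi (- int q - 1) = 1 / \<tau> ^ (q + 1)"
      by (simp only: power_int_minus power_int_of_nat inverse_eq_divide)
    then show ?thesis
      using F'(3) assms(9) by (simp only:) (simp add: field_simps)
  qed
  ultimately show ?thesis
    using S F'(1,2)
    by - (rule exI[of _ \<S>], rule exI[of _ \<F>'], intro conjI ballI, assumption+, simp_all)
qed

end
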